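(* Let $T:\mathcal{B}(I)\to\mathcal{B}(I)$ be the Read-Bajraktarević operator defined, for $h\in\mathcal{B}(I)$, by $$Th(t)=F_j\big(l_j^{-1}(t),h(l_j^{-1}(t))\big)=c_j\,l_j^{-1}(t)+\delta_j\,s_j\big(h(l_j^{-1}(t))\big)+d_j,\qquad t\in I_j,\ j\in\{1,\dots,N\},$$ with $I, I_j, l_j, F_j, s_j, c_j, d_j, \delta_j$ as in the context. Then $T$ is a Rakotch contraction on $\mathcal{B}(I)$ (with the metric induced by $\|\cdot\|_\infty$), and $T$ has a unique fixed point $f\in\mathcal{B}(I)$; it satisfies $$f(t)=c_j\,l_j^{-1}(t)+\delta_j\,s_j\big(f(l_j^{-1}(t))\big)+d_j\qquad\text{for all } t\in I_j,\ j\in\{1,\dots,N\}.$$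
   Context: Rakotch contraction: let $(X,\rho)$ be a metric space and $\mathbb{R}_+=[0,\infty)$. A map $g:X\to X$ is a Rakotch contraction with respect to a function $\psi:\mathbb{R}_+\to\mathbb{R}_+$ if $\rho(g(x),g(y))\le\psi(\rho(x,y))$ for all $x,y\in X$, where $\psi$ satisfies $\frac{\psi(s)}{s}<1$ for all $s>0$ and $\frac{\psi(t)}{t}\le\frac{\psi(s)}{s}$ for all $t>s>0$. A map is a Rakotch contraction if it is one with respect to some such $\psi$. Setting: $N>1$ is an integer, $t_0<t_1<\dots<t_N$ are real numbers, $I=[t_0,t_N]$, $I_j=[t_{j-1},t_j)$ for $1\le j\le N-1$, and $I_N=[t_{N-1},t_N]$. For $1\le j\le N$, $l_j:I\to I$ is the affine map $l_j(t)=a_jt+b_j$ determined by $l_j(t_0)=t_{j-1}$ and $l_j(t_N)=t_j$. The maps $F_j:I\times\mathbb{R}\to\mathbb{R}$ are $F_j(t,x)=c_jt+\delta_js_j(x)+d_j$, where $s_1,\dots,s_N:\mathbb{R}\to\mathbb{R}$ are Rakotch contractions (for the usual metric on $\mathbb{R}$) all with respect to the same function $\psi$, and $c_j,d_j,\delta_j$ are real constants. Put $\delta=\max_{1\le j\le N}|\delta_j|$. The $\delta_j$ are chosen so that: if $\sup_{t>0}\frac{\psi(t)}{t}<1$, then for some fixed $\beta$ with $\sup_{t>0}\frac{\psi(t)}{t}<\beta<1$ one has $\delta<\frac1\beta$; if $\sup_{t>0}\frac{\psi(t)}{t}=1$, then $\delta<1$. $\mathcal{B}(I)$ is the space of bounded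 real-valued functions on $I$ with the norm $\|h\|_\infty=\sup_{t\in I}|h(t)|$. *)

theory Defs
  imports "HOL-Analysis.Analysis"
begin

definition Rakotch_contraction_wrt ::
    "'a metric \<Rightarrow> (real \<Rightarrow> real) \<Rightarrow> ('a \<Rightarrow> 'a) \<Rightarrow> bool" where
  "Rakotch_contraction_wrt m \<psi> g \<longleftrightarrow>
     g \<in> mspace m \<rightarrow> mspace m \<and>
     \<psi> \<in> {0..} \<rightarrow> {0..} \<and>
     (\<forall>s>0. \<psi> s / s < 1) \<and>
     (\<forall>s>0. \<forall>t>s. \<psi> t / t \<le> \<psi> s / s) \<and>
     (\<forall>x\<in>mspace m. \<forall>y\<in>mspace m. mdist m (g x) (g y) \<le> \<psi> (mdist m x y))"

definition Rakotch_contraction :: "'a metric \<Rightarrow> ('a \<Rightarrow> 'a) \<Rightarrow> bool" where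
  "Rakotch_contraction m g \<longleftrightarrow> (\<exists>\<psi>. Rakotch_contraction_wrt m \<psi> g)"

text \<open>Functions on \<open>I\<close> are represented by total functions that are \<open>undefined\<close> outside \<open>I\<close>,
  so that functions agreeing on \<open>I\<close> are equal.\<close>

abbreviation bounded_funs :: "real set \<Rightarrow> (real \<Rightarrow> real) metric" where
  "bounded_funs I \<equiv> funspace I euclidean_metric"

lemma mspace_bounded_funs:
  "mspace (bounded_funs I) = {h \<in> extensional I. bounded (h ` I)}"
  by (auto simp: Met_TC.fspace_def)

lemma mdist_bounded_funs:
  assumes "f \<in> mspace (bounded_funs I)" "g \<in> mspace (bounded_funs I)" "I \<noteq> {}"
  shows "mdist (bounded_funs I) f g = (SUP x\<in>I. \<bar>f x - g x\<bar>)"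
  using assms by (simp add: Met_TC.fdist_def dist_real_def)

definition piece :: "nat \<Rightarrow> (nat \<Rightarrow> real) \<Rightarrow> nat \<Rightarrow> real set" where
  "piece N t j = (if j = N then {t (N - 1)..t N} else {t (j - 1)..<t j})"

definition Read_Bajraktarevic ::
    "nat \<Rightarrow> (nat \<Rightarrow> real) \<Rightarrow> (nat \<Rightarrow> real \<Rightarrow> real) \<Rightarrow> (nat \<Rightarrow> real \<Rightarrow> real \<Rightarrow> real)
      \<Rightarrow> (real \<Rightarrow> real) \<Rightarrow> (real \<Rightarrow> real)" where
  "Read_Bajraktarevic N t l F h =
     (\<lambda>x\<in>{t 0..t N}.
        let j = (THE j. j \<in> {1..N} \<and> x \<in> piece N t j);
            u = inv_into {t 0..t N} (l j) x
        in F j u (h u))"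

lemma piece_unique:
  assumes t: "strict_mono_on {..N} t"
    and i: "i \<in> {1..N}" "x \<in> piece N t i" and j: "j \<in> {1..N}" "x \<in> piece N t j"
  shows "i = j"
proof -
  have mono: "t p \<le> t q" if "p \<le> q" "q \<le> N" for p q
    using strict_mono_onD[OF t, of p q] that by (cases "p = q") auto
  have False if "p < q" "p \<in> {1..N}" "q \<in> {1..N}" "x \<in> piece N t p" "x \<in> piece N t q" for p q
  proof -
    have "t p \<le> t (q - 1)"
      using that by (intro mono) auto
    with that show False
      by (auto simp: piece_def split: if_splits)
  qed
  then show ?thesis
    using i j by (metis linorder_neqE_nat)
qed

lemma piece_subset:
  assumes t: "strict_mono_on {..N} t" and j: "j \<in> {1..N}"
  shows "piece N t j \<subseteq> {t 0..t N}"
proof -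
  have mono: "t p \<le> t q" if "p \<le> q" "q \<le> N" for p q
    using strict_mono_onD[OF t, of p q] that by (cases "p = q") auto
  have "t 0 \<le> t (j - 1)" "t j \<le> t N"
    using j by (auto intro!: mono)
  then show ?thesis
    by (auto simp: piece_def)
qed

lemma Read_Bajraktarevic_eq:
  assumes "strict_mono_on {..N} t" "j \<in> {1..N}" "x \<in> piece N t j"
  shows "Read_Bajraktarevic N t l F h x =
    F j (inv_into {t 0..t N} (l j) x) (h (inv_into {t 0..t N} (l j) x))"
proof -
  have "(THE j. j \<in> {1..N} \<and> x \<in> piece N t j) = j"
    using assms piece_unique by (intro the_equality) blast+
  moreover have "x \<in> {t 0..t N}"
    using piece_subset assms by blast
  ultimately show ?thesis
    by (simp add: Read_Bajraktarevic_def Let_def)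
qed

end

theory Submission
  imports Defs
begin

text \<open>Two ingredients. First, Rakotch's fixed point theorem: once the step \<open>\<rho>(x\<^sub>n, f x\<^sub>n)\<close> of a Picard
  orbit is small compared with \<open>\<epsilon>\<close>, the ball of radius \<open>\<epsilon>\<close> around \<open>x\<^sub>n\<close> is mapped into itself, so the
  orbit is Cauchy. Second, \<open>T\<close> is pointwise controlled by \<open>\<delta> \<psi>(\<bar>g u - h u\<bar>)\<close>. As \<open>\<psi>\<close> need not be
  monotone, passing to the supremum over \<open>u\<close> requires a function dominating \<open>\<delta> \<psi>\<close> on all of \<open>[0, r]\<close>;
  \<open>\<delta> \<beta> r\<close> does it if \<open>\<psi>(r)/r \<le> \<beta>\<close>, and \<open>r max (1/2) (\<psi>(r/2)/(r/2))\<close> if \<open>\<delta> < 1\<close>.\<close>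

section \<open>Rakotch contractions\<close>

text \<open>Since the ratio \<open>\<psi> p / p\<close> does not increase with \<open>p\<close>, its
  value at a threshold \<open>r\<close> serves all larger distances. Thus pairs at least
  \<open>r\<close> apart are contracted by one common factor below 1, as under a Banach
  contraction.\<close>

lemma Rakotch_contraction_wrt_le_ratio:
  assumes "Rakotch_contraction_wrt m \<psi> f" "x \<in> mspace m" "y \<in> mspace m"
    and "0 < r" "r \<le> mdist m x y"
  shows "mdist m (f x) (f y) \<le> \<psi> r / r * mdist m x y"
proof -
  let ?p = "mdist m x y"
  have "\<psi> ?p / ?p \<le> \<psi> r / r"
    using assms by (cases "r = ?p") (auto simp: Rakotch_contraction_wrt_def)
  then have "\<psi> ?p \<le> \<psi> r / r * ?p"
    using assms by (simp add: pos_divide_le_eq)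
  moreover have "mdist m (f x) (f y) \<le> \<psi> ?p"
    using assms by (simp add: Rakotch_contraction_wrt_def)
  ultimately show ?thesis by simp
qed

lemma Rakotch_contraction_wrt_nonexpansive:
  assumes f: "Rakotch_contraction_wrt m \<psi> f" and xy: "x \<in> mspace m" "y \<in> mspace m"
  shows "mdist m (f x) (f y) \<le> mdist m x y"
\<comment> \<open>\<open>\<psi> 0\<close> may be positive, so the defining inequality does not
  settle coinciding points.\<close>
proof (cases "x = y")
  case True
  moreover have "f y \<in> mspace m"
    using f xy by (auto simp: Rakotch_contraction_wrt_def)
  ultimately have "mdist m (f x) (f y) = 0"
    by (metis mdist_zero)
  then show ?thesis by simp
next
  case False
  then have p: "0 < mdist m x y"
    using xy by (simp add: order_less_le)
  have "\<psi> (mdist m x y) / mdist m x y < 1"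
    using f p by (auto simp: Rakotch_contraction_wrt_def)
  then have "\<psi> (mdist m x y) / mdist m x y * mdist m x y \<le> 1 * mdist m x y"
    using p by (intro mult_right_mono) auto
  then show ?thesis
    using Rakotch_contraction_wrt_le_ratio[OF f xy p] by simp
qed

lemma Rakotch_contraction_wrt_fixpoint_unique:
  assumes f: "Rakotch_contraction_wrt m \<psi> f" and xy: "x \<in> mspace m" "y \<in> mspace m"
    and fixed: "f x = x" "f y = y"
  shows "x = y"
proof (rule ccontr)
  assume "x \<noteq> y"
  then have p: "0 < mdist m x y"
    using xy by (simp add: order_less_le)
  have "\<psi> (mdist m x y) / mdist m x y < 1"
    using f p by (auto simp: Rakotch_contraction_wrt_def)
  then have "\<psi> (mdist m x y) / mdist m x y * mdist m x y < 1 * mdist m x y"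
    using p by (intro mult_strict_right_mono) auto
  then show False
    using Rakotch_contraction_wrt_le_ratio[OF f xy p] fixed by simp
qed

theorem Rakotch_fixpoint:
  assumes f: "Rakotch_contraction_wrt m \<psi> f" and complete: "mcomplete_of m"
    and nonempty: "mspace m \<noteq> {}"
  obtains x where "x \<in> mspace m" "f x = x"
proof -
  interpret Metric_space "mspace m" "mdist m"
    by (rule Metric_space_mspace_mdist)
  have fim: "f x \<in> mspace m" if "x \<in> mspace m" for x
    using f that by (auto simp: Rakotch_contraction_wrt_def)
  have ratio: "0 \<le> \<psi> r / r" "\<psi> r / r < 1" if "0 < r" for r
    using f that by (auto simp: Rakotch_contraction_wrt_def Pi_iff)
  obtain x0 where x0: "x0 \<in> mspace m"
    using nonempty by blast
  define \<sigma> where "\<sigma> n = (f ^^ n) x0" for n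
  have \<sigma>Suc: "\<sigma> (Suc n) = f (\<sigma> n)" for n
    by (simp add: \<sigma>_def)
  have \<sigma>in [simp]: "\<sigma> n \<in> mspace m" for n
    by (induction n) (auto simp: \<sigma>Suc fim, simp add: \<sigma>_def x0)
  \<comment> \<open>If every step had length at least \<epsilon>, each would be shorter than its
    predecessor by the fixed factor \<open>\<psi> \<epsilon> / \<epsilon>\<close> below 1, and
    geometric decay would push the lengths below \<epsilon>.\<close>
  have small_step: "\<exists>n. mdist m (\<sigma> n) (\<sigma> (Suc n)) < \<epsilon>" if "0 < \<epsilon>" for \<epsilon>
  proof (rule ccontr)
    assume "\<not> ?thesis"
    then have ge: "\<epsilon> \<le> mdist m (\<sigma> n) (\<sigma> (Suc n))" for n
      by (auto simp: not_less)
    define q where "q = \<psi> \<epsilon> / \<epsilon>"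
    have q: "0 \<le> q" "q < 1"
      using ratio that by (auto simp: q_def)
    have decay: "mdist m (\<sigma> n) (\<sigma> (Suc n)) \<le> q ^ n * mdist m (\<sigma> 0) (\<sigma> 1)" for n
    proof (induction n)
      case (Suc n)
      have "mdist m (\<sigma> (Suc n)) (\<sigma> (Suc (Suc n))) \<le> q * mdist m (\<sigma> n) (\<sigma> (Suc n))"
        unfolding q_def \<sigma>Suc[of n] \<sigma>Suc[of "Suc n"]
        using ge[of n] that by (intro Rakotch_contraction_wrt_le_ratio[OF f]) (auto simp: \<sigma>Suc fim)
      also have "\<dots> \<le> q * (q ^ n * mdist m (\<sigma> 0) (\<sigma> 1))"
        using q Suc by (intro mult_left_mono)
      finally show ?case by simp
    qed simp
    have "0 < mdist m (\<sigma> 0) (\<sigma> 1)"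
      using ge[of 0] that by (metis One_nat_def order_less_le_trans)
    then obtain n where "q ^ n < \<epsilon> / mdist m (\<sigma> 0) (\<sigma> 1)"
      using real_arch_pow_inv[OF divide_pos_pos[OF \<open>0 < \<epsilon>\<close>] q(2)] by blast
    then have "q ^ n * mdist m (\<sigma> 0) (\<sigma> 1) < \<epsilon>"
      using \<open>0 < mdist m (\<sigma> 0) (\<sigma> 1)\<close> by (simp add: pos_less_divide_eq)
    with decay[of n] ge[of n] show False by simp
  qed
  have trapped: "\<exists>n. \<forall>k\<ge>n. mdist m (\<sigma> n) (\<sigma> k) \<le> \<epsilon>" if "0 < \<epsilon>" for \<epsilon>
  proof -
    \<comment> \<open>The threshold \<open>\<epsilon> / 2\<close> splits the ball: points within it
      move by less than \<open>\<epsilon> / 2\<close> and do not spread apart, points beyond it are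
      contracted by \<open>q\<close>. The two bounds on the step match these cases, the second
      through \<open>(1 - q) * \<epsilon> + q * \<epsilon> = \<epsilon>\<close>.\<close>
    define q where "q = \<psi> (\<epsilon> / 2) / (\<epsilon> / 2)"
    have q: "0 \<le> q" "q < 1"
      using ratio[of "\<epsilon> / 2"] that by (auto simp: q_def)
    have "0 < min (\<epsilon> / 2) ((1 - q) * \<epsilon>)"
      using q that by auto
    from small_step[OF this] obtain n
      where n: "mdist m (\<sigma> n) (\<sigma> (Suc n)) < \<epsilon> / 2" "mdist m (\<sigma> n) (\<sigma> (Suc n)) < (1 - q) * \<epsilon>"
      by auto
    have "mdist m (\<sigma> n) (\<sigma> k) \<le> \<epsilon>" if "n \<le> k" for k
      using that
    proof (induction k rule: dec_induct)
      case base
      then show ?case using \<open>0 < \<epsilon>\<close> by simp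
    next
      case (step k)
      \<comment> \<open>Going through \<open>\<sigma> (Suc n)\<close>, which is
        \<open>f (\<sigma> n)\<close>, turns the second summand into a distance of two images under
        \<open>f\<close>.\<close>
      have tri: "mdist m (\<sigma> n) (\<sigma> (Suc k))
          \<le> mdist m (\<sigma> n) (\<sigma> (Suc n)) + mdist m (f (\<sigma> n)) (f (\<sigma> k))"
        using triangle[of "\<sigma> n" "\<sigma> (Suc n)" "\<sigma> (Suc k)"] by (simp add: \<sigma>Suc fim)
      show ?case
      proof (cases "mdist m (\<sigma> n) (\<sigma> k) \<le> \<epsilon> / 2")
        case True
        then show ?thesis
          using tri n(1) Rakotch_contraction_wrt_nonexpansive[OF f \<sigma>in \<sigma>in, of n k] by simp
      next
        case False
        then have "mdist m (f (\<sigma> n)) (f (\<sigma> k)) \<le> q * mdist m (\<sigma> n) (\<sigma> k)"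
          unfolding q_def using \<open>0 < \<epsilon>\<close>
          by (intro Rakotch_contraction_wrt_le_ratio[OF f]) auto
        also have "\<dots> \<le> q * \<epsilon>"
          using q step.IH by (intro mult_left_mono)
        finally show ?thesis
          using tri n(2) by (simp add: algebra_simps)
      qed
    qed
    then show ?thesis by blast
  qed
  have "MCauchy \<sigma>"
    unfolding MCauchy_def
  proof (intro conjI allI impI)
    fix \<epsilon> :: real
    assume "0 < \<epsilon>"
    \<comment> \<open>\<open>trapped\<close> gives only a non-strict bound; with thirds, two such
      distances still add up to less than \<epsilon>.\<close>
    then obtain n where n: "\<And>k. n \<le> k \<Longrightarrow> mdist m (\<sigma> n) (\<sigma> k) \<le> \<epsilon> / 3"
      using trapped[of "\<epsilon> / 3"] by auto
    have "mdist m (\<sigma> i) (\<sigma> j) < \<epsilon>" if "n \<le> i" "n \<le> j" for i j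
      using triangle[of "\<sigma> i" "\<sigma> n" "\<sigma> j"] n[of i] n[of j] that \<open>0 < \<epsilon>\<close>
      by (simp add: commute[of "\<sigma> i" "\<sigma> n"])
    then show "\<exists>n. \<forall>i j. n \<le> i \<longrightarrow> n \<le> j \<longrightarrow> mdist m (\<sigma> i) (\<sigma> j) < \<epsilon>"
      by blast
  qed auto
  then obtain x where x: "limitin mtopology \<sigma> x sequentially"
    using complete by (auto simp: mcomplete_of_def mcomplete_def)
  then have xin: "x \<in> mspace m"
    by (simp add: limitin_mspace)
  \<comment> \<open>The limit is fixed because \<open>f\<close> is nonexpansive: \<open>f x\<close>
    is at least as close to \<open>\<sigma> (Suc n)\<close> as \<open>x\<close> is to
    \<open>\<sigma> n\<close>.\<close>
  have "mdist m (f x) x \<le> 0 + \<epsilon>" if "0 < \<epsilon>" for \<epsilon>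
  proof -
    obtain n where n: "\<And>k. n \<le> k \<Longrightarrow> mdist m (\<sigma> k) x < \<epsilon> / 2"
      using x \<open>0 < \<epsilon>\<close> unfolding limit_metric_sequentially by (meson half_gt_zero)
    have "mdist m (f x) x \<le> mdist m (f (\<sigma> n)) (f x) + mdist m (\<sigma> (Suc n)) x"
      using triangle[of "f x" "\<sigma> (Suc n)" x] xin
      by (simp add: \<sigma>Suc fim commute[of "f x" "f (\<sigma> n)"])
    also have "\<dots> \<le> \<epsilon>"
      using Rakotch_contraction_wrt_nonexpansive[OF f \<sigma>in xin, of n] n[of n] n[of "Suc n"] by simp
    finally show ?thesis by simp
  qed
  then have "mdist m (f x) x \<le> 0"
    by (rule field_le_epsilon)
  moreover have "0 \<le> mdist m (f x) x"
    by simp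
  ultimately have "f x = x"
    using zero[OF fim[OF xin] xin] by linarith
  then show thesis
    using that xin by blast
qed

text \<open>The result \<phi> satisfies the three conditions on a control function again, so it can
  witness that the operator itself is a Rakotch contraction. The range \<open>0 < p\<close> leaves
  out coinciding values, where \<open>\<psi> 0\<close> is unrestricted while both choices of \<phi>
  vanish at 0.\<close>

lemma Rakotch_scaled_majorant:
  fixes D :: real and \<psi> :: "real \<Rightarrow> real"
  assumes \<psi>: "\<psi> \<in> {0..} \<rightarrow> {0..}" "\<forall>s>0. \<psi> s / s < 1" "\<forall>s>0. \<forall>t>s. \<psi> t / t \<le> \<psi> s / s"
    and D: "0 \<le> D"
    and less: "(SUP r\<in>{0<..}. \<psi> r / r) < 1 \<Longrightarrow>
           \<exists>\<beta>. (SUP r\<in>{0<..}. \<psi> r / r) < \<beta> \<and> \<beta> < 1 \<and> D < 1 / \<beta>"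
    and eq: "(SUP r\<in>{0<..}. \<psi> r / r) = 1 \<Longrightarrow> D < 1"
  obtains \<phi> where "\<phi> \<in> {0..} \<rightarrow> {0..}" "\<forall>s>0. \<phi> s / s < 1" "\<forall>s>0. \<forall>t>s. \<phi> t / t \<le> \<phi> s / s"
    "\<And>p r. 0 < p \<Longrightarrow> p \<le> r \<Longrightarrow> D * \<psi> p \<le> \<phi> r"
proof -
  let ?S = "SUP r\<in>{0<..}. \<psi> r / r"
  have nonneg: "0 \<le> \<psi> r" if "0 \<le> r" for r
    using \<psi>(1) that by auto
  have lt1: "\<psi> r / r < 1" if "0 < r" for r
    using \<psi>(2) that by blast
  have "bdd_above ((\<lambda>r. \<psi> r / r) ` {0<..})"
    using lt1 by (intro bdd_aboveI2[where M = 1]) (auto intro: less_imp_le)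
  then have ratio_le: "\<psi> r / r \<le> ?S" if "0 < r" for r
    using that by (intro cSUP_upper) auto
  have "?S \<le> 1"
    using lt1 by (intro cSUP_least) (auto intro: less_imp_le)
  then consider "?S < 1" | "?S = 1" by linarith
  then show thesis
  proof cases
    case 1
    then obtain \<beta> where \<beta>: "?S < \<beta>" "D < 1 / \<beta>"
      using less by blast
    \<comment> \<open>A single ratio, here at 1, shows that the supremum is nonnegative. Hence
      \<beta> is positive and \<open>D < 1 / \<beta>\<close> can be read as
      \<open>D * \<beta> < 1\<close>, even if \<open>D\<close> exceeds 1.\<close>
    have "0 \<le> \<psi> 1 / 1"
      using nonneg[of 1] by simp
    then have "0 < \<beta>"
      using ratio_le[of 1] \<beta>(1) by linarith
    show thesis
    proof (rule that[of "\<lambda>r. D * \<beta> * r"])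
      show "\<forall>s>0. D * \<beta> * s / s < 1"
        using \<beta>(2) \<open>0 < \<beta>\<close> by (simp add: pos_less_divide_eq)
      show "D * \<psi> p \<le> D * \<beta> * r" if "0 < p" "p \<le> r" for p r
      proof -
        have "\<psi> p / p \<le> \<beta>"
          using ratio_le[OF \<open>0 < p\<close>] \<beta>(1) by linarith
        then have "\<psi> p \<le> \<beta> * p"
          using \<open>0 < p\<close> by (simp add: pos_divide_le_eq)
        also have "\<dots> \<le> \<beta> * r"
          using \<open>0 < \<beta>\<close> \<open>p \<le> r\<close> by simp
        finally show ?thesis
          using D by (simp add: mult_left_mono mult.assoc)
      qed
    qed (use D \<open>0 < \<beta>\<close> in auto)
  next
    case 2
    then have "D < 1" by (rule eq)
    \<comment> \<open>The entry \<open>1 / 2\<close> covers \<open>p \<le> r / 2\<close>, where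
      \<open>\<psi> p \<le> p\<close> suffices; the ratio at \<open>r / 2\<close> covers
      \<open>p\<close> between \<open>r / 2\<close> and \<open>r\<close>. The maximum of the two
      stays below 1 and does not increase with \<open>r\<close>.\<close>
    define q where "q r = max (1 / 2) (\<psi> (r / 2) / (r / 2))" for r
    have q_mono: "q v \<le> q u" if "0 < u" "u < v" for u v
    proof -
      have "\<psi> (v / 2) / (v / 2) \<le> \<psi> (u / 2) / (u / 2)"
        using \<psi>(3)[rule_format, of "u / 2" "v / 2"] that by simp
      then show ?thesis
        unfolding q_def by (intro max.mono order_refl)
    qed
    show thesis
    proof (rule that[of "\<lambda>r. q r * r"])
      show "(\<lambda>r. q r * r) \<in> {0..} \<rightarrow> {0..}"
        by (auto simp: q_def intro!: mult_nonneg_nonneg)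
      show "\<forall>s>0. q s * s / s < 1"
        using lt1[of "s / 2" for s] by (simp add: q_def)
      show "\<forall>s>0. \<forall>t>s. q t * t / t \<le> q s * s / s"
        using q_mono by auto
      show "D * \<psi> p \<le> q r * r" if p: "0 < p" "p \<le> r" for p r
      proof -
        have "\<psi> p \<le> q r * r"
        proof (cases "p \<le> r / 2")
          case True
          have "\<psi> p \<le> p"
            using lt1[OF p(1)] p(1) by (simp add: pos_divide_less_eq)
          also have "\<dots> \<le> 1 / 2 * r"
            using True by simp
          also have "\<dots> \<le> q r * r"
            using p by (intro mult_right_mono) (auto simp: q_def)
          finally show ?thesis .
        next
          case False
          then have "\<psi> p / p \<le> \<psi> (r / 2) / (r / 2)"
            using p \<psi>(3)[rule_format, of "r / 2" p] by linarith
          also have "\<dots> \<le> q r"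
            by (simp add: q_def)
          finally have "\<psi> p \<le> q r * p"
            using p by (simp add: pos_divide_le_eq)
          also have "\<dots> \<le> q r * r"
            using p by (intro mult_left_mono) (auto simp: q_def)
          finally show ?thesis .
        qed
        moreover have "D * \<psi> p \<le> 1 * \<psi> p"
          using D \<open>D < 1\<close> nonneg[of p] p by (intro mult_right_mono) auto
        ultimately show ?thesis by simp
      qed
    qed
  qed
qed

section \<open>The Read-Bajraktarevic operator\<close>

lemma piece_exists:
  fixes t :: "nat \<Rightarrow> real"
  assumes N: "0 < N" and x: "x \<in> {t 0..t N}"
  obtains j where "j \<in> {1..N}" "x \<in> piece N t j"
proof (cases "t (N - 1) \<le> x")
  case True
  then show ?thesis
    using that[of N] x N by (auto simp: piece_def)
next
  case False
  \<comment> \<open>The first node beyond \<open>x\<close> is the right end of its piece: minimality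
    gives \<open>t (j - 1) \<le> x\<close>, and \<open>j \<le> N - 1\<close> makes the piece
    half-open.\<close>
  define j where "j = (LEAST j. x < t j)"
  have "x < t (N - 1)"
    using False by simp
  then have j: "x < t j" "j \<le> N - 1"
    unfolding j_def by (auto intro: LeastI Least_le)
  have "j \<noteq> 0"
    using j x by (metis atLeastAtMost_iff not_less)
  then have "\<not> x < t (j - 1)"
    unfolding j_def by (intro not_less_Least) simp
  then have "x \<in> piece N t j"
    using j \<open>j \<noteq> 0\<close> by (auto simp: piece_def)
  with that[of j] j \<open>j \<noteq> 0\<close> show ?thesis by simp
qed

text \<open>By the intermediate value theorem \<open>x\<close> is attained on the interval, so
  \<open>inv_into\<close> picks a genuine preimage rather than an arbitrary default value.\<close>

lemma inv_into_affine_in: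
  fixes l :: "real \<Rightarrow> real"
  assumes l: "\<And>u. u \<in> {p..q} \<Longrightarrow> l u = a * u + b" and "p \<le> q"
    and x: "l p \<le> x" "x \<le> l q"
  shows "inv_into {p..q} l x \<in> {p..q}"
proof (rule inv_into_into)
  have "continuous_on {p..q} l"
    using l by (subst continuous_on_cong[OF refl, of _ _ "\<lambda>u. a * u + b"]) (auto intro!: continuous_intros)
  then show "x \<in> l ` {p..q}"
    using IVT'[OF x \<open>p \<le> q\<close>] by (auto simp: image_iff)
qed

theorem theorem1:
  fixes N :: nat and t :: "nat \<Rightarrow> real" and I :: "real set"
    and a b c d \<delta> :: "nat \<Rightarrow> real" and \<psi> :: "real \<Rightarrow> real"
    and l s :: "nat \<Rightarrow> real \<Rightarrow> real" and F :: "nat \<Rightarrow> real \<Rightarrow> real \<Rightarrow> real"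
    and \<delta>max :: real and T :: "(real \<Rightarrow> real) \<Rightarrow> (real \<Rightarrow> real)"
  assumes N: "N > 1"
    and t: "strict_mono_on {..N} t"
    and I: "I = {t 0..t N}"
    and l: "\<And>j u. j \<in> {1..N} \<Longrightarrow> u \<in> I \<Longrightarrow> l j u = a j * u + b j"
    and l_left: "\<And>j. j \<in> {1..N} \<Longrightarrow> l j (t 0) = t (j - 1)"
    and l_right: "\<And>j. j \<in> {1..N} \<Longrightarrow> l j (t N) = t j"
    and s: "\<And>j. j \<in> {1..N} \<Longrightarrow> Rakotch_contraction_wrt euclidean_metric \<psi> (s j)"
    and F: "\<And>j u x. j \<in> {1..N} \<Longrightarrow> u \<in> I \<Longrightarrow> F j u x = c j * u + \<delta> j * s j x + d j"
    and \<delta>max: "\<delta>max = Max ((\<lambda>j. \<bar>\<delta> j\<bar>) ` {1..N})"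
    and \<delta>_sup_less: "(SUP r\<in>{0<..}. \<psi> r / r) < 1 \<Longrightarrow>
           \<exists>\<beta>. (SUP r\<in>{0<..}. \<psi> r / r) < \<beta> \<and> \<beta> < 1 \<and> \<delta>max < 1 / \<beta>"
    and \<delta>_sup_eq: "(SUP r\<in>{0<..}. \<psi> r / r) = 1 \<Longrightarrow> \<delta>max < 1"
    and T: "T = Read_Bajraktarevic N t l F"
  shows "Rakotch_contraction (bounded_funs I) T \<and>
    (\<exists>f\<in>mspace (bounded_funs I).
       T f = f \<and>
       (\<forall>g\<in>mspace (bounded_funs I). T g = g \<longrightarrow> g = f) \<and>
       (\<forall>j\<in>{1..N}. \<forall>x\<in>piece N t j.
          f x = c j * inv_into I (l j) x + \<delta> j * s j (f (inv_into I (l j) x)) + d j))"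
proof -
  let ?B = "bounded_funs I"
  define u where "u j x = inv_into I (l j) x" for j x
  have t0N: "t 0 < t N"
    using strict_mono_onD[OF t, of 0 N] N by simp
  then have Ine: "I \<noteq> {}"
    by (simp add: I)
  have bounded_funsI: "h \<in> mspace ?B"
    if "h \<in> extensional I" "\<And>x. x \<in> I \<Longrightarrow> \<bar>h x\<bar> \<le> K" for h :: "real \<Rightarrow> real" and K
    unfolding mspace_bounded_funs using that by (auto simp: bounded_iff)
  have uin: "u j x \<in> I" if j: "j \<in> {1..N}" and x: "x \<in> piece N t j" for j x
    unfolding u_def I
  proof (rule inv_into_affine_in)
    show "l j v = a j * v + b j" if "v \<in> {t 0..t N}" for v
      using l j that by (simp add: I)
    show "l j (t 0) \<le> x" "x \<le> l j (t N)"
      using x j by (auto simp: l_left l_right piece_def split: if_splits)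
  qed (use t0N in simp)
  \<comment> \<open>The formula for \<open>F j\<close> is given only for first arguments in
    \<open>I\<close>; \<open>uin\<close> ensures that the preimage lies there.\<close>
  have T_eq: "T h x = c j * u j x + \<delta> j * s j (h (u j x)) + d j"
    if "j \<in> {1..N}" "x \<in> piece N t j" for h j x
    using Read_Bajraktarevic_eq[OF t that, of l F h] uin[OF that] F that
    by (simp add: T u_def I)
  have pieceE: thesis if "x \<in> I" "\<And>j. \<lbrakk>j \<in> {1..N}; x \<in> piece N t j\<rbrakk> \<Longrightarrow> thesis" for x thesis
    using piece_exists[of N x t] N that I by auto
  have \<delta>_le: "\<bar>\<delta> j\<bar> \<le> \<delta>max" if "j \<in> {1..N}" for j
    unfolding \<delta>max using that by (intro Max_ge) auto
  have \<delta>0: "0 \<le> \<delta>max"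
    using \<delta>_le[of 1] N by simp
  \<comment> \<open>The conditions on \<psi> alone are contained in the contraction property of each
    \<open>s j\<close>; the index 1 serves to extract them.\<close>
  have "1 \<in> {1..N}"
    using N by simp
  from s[OF this] have \<psi>: "\<psi> \<in> {0..} \<rightarrow> {0..}" "\<forall>s>0. \<psi> s / s < 1"
    "\<forall>s>0. \<forall>t>s. \<psi> t / t \<le> \<psi> s / s"
    unfolding Rakotch_contraction_wrt_def by auto
  obtain \<phi> where \<phi>: "\<phi> \<in> {0..} \<rightarrow> {0..}" "\<forall>s>0. \<phi> s / s < 1"
      "\<forall>s>0. \<forall>t>s. \<phi> t / t \<le> \<phi> s / s"
    and major: "\<And>p r. 0 < p \<Longrightarrow> p \<le> r \<Longrightarrow> \<delta>max * \<psi> p \<le> \<phi> r"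
    by (rule Rakotch_scaled_majorant[OF \<psi> \<delta>0 \<delta>_sup_less \<delta>_sup_eq]) auto
  have s_le: "\<bar>s j v - s j w\<bar> \<le> \<psi> \<bar>v - w\<bar>" if "j \<in> {1..N}" for j v w
    using s[OF that] by (simp add: Rakotch_contraction_wrt_def dist_real_def)
  have s_nonexp: "\<bar>s j v - s j w\<bar> \<le> \<bar>v - w\<bar>" if "j \<in> {1..N}" for j v w
    using Rakotch_contraction_wrt_nonexpansive[OF s[OF that], of v w] by (simp add: dist_real_def)
  \<comment> \<open>Stating this for every \<open>r\<close> above \<open>\<bar>v - w\<bar>\<close>
    allows \<open>r\<close> to be the sup distance of two functions later on.\<close>
  have \<delta>s_le: "\<bar>\<delta> j * s j v - \<delta> j * s j w\<bar> \<le> \<phi> r"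
    if j: "j \<in> {1..N}" and r: "\<bar>v - w\<bar> \<le> r" for j v w r
  proof (cases "v = w")
    case True
    then show ?thesis
      using \<phi>(1) r by auto
  next
    case False
    have "\<bar>\<delta> j * s j v - \<delta> j * s j w\<bar> = \<bar>\<delta> j\<bar> * \<bar>s j v - s j w\<bar>"
      by (simp add: abs_mult flip: right_diff_distrib)
    also have "\<dots> \<le> \<delta>max * \<psi> \<bar>v - w\<bar>"
      using \<delta>_le[OF j] s_le[OF j] \<delta>0 by (intro mult_mono) auto
    also have "\<dots> \<le> \<phi> r"
      using False r by (intro major) auto
    finally show ?thesis .
  qed
  have Tin: "T h \<in> mspace ?B" if h: "h \<in> mspace ?B" for h
  proof -
    from h obtain K where K: "\<And>x. x \<in> I \<Longrightarrow> \<bar>h x\<bar> \<le> K"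
      unfolding mspace_bounded_funs by (auto simp: bounded_iff)
    define R where "R = max \<bar>t 0\<bar> \<bar>t N\<bar>"
    \<comment> \<open>This bounds \<open>T h\<close> on piece \<open>j\<close>: \<open>R\<close>
      bounds the points of \<open>I\<close>, and comparing with the value at 0 bounds
      \<open>s j\<close> on \<open>[-K, K]\<close>, since \<open>s j\<close> is nonexpansive. The
      maximum over the finitely many pieces is then a global bound.\<close>
    define C where "C j = \<bar>c j\<bar> * R + \<bar>\<delta> j\<bar> * (\<bar>s j 0\<bar> + K) + \<bar>d j\<bar>" for j
    show ?thesis
    proof (rule bounded_funsI)
      show "T h \<in> extensional I"
        by (simp add: T I Read_Bajraktarevic_def)
      fix x assume "x \<in> I"
      then obtain j where j: "j \<in> {1..N}" "x \<in> piece N t j"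
        by (rule pieceE)
      have "\<bar>u j x\<bar> \<le> R"
        using uin[OF j] by (auto simp: I R_def)
      moreover have "\<bar>s j (h (u j x))\<bar> \<le> \<bar>s j 0\<bar> + K"
        using s_nonexp[OF j(1), of "h (u j x)" 0] K[OF uin[OF j]] by simp
      ultimately have "\<bar>c j * u j x\<bar> \<le> \<bar>c j\<bar> * R"
        "\<bar>\<delta> j * s j (h (u j x))\<bar> \<le> \<bar>\<delta> j\<bar> * (\<bar>s j 0\<bar> + K)"
        by (auto simp: abs_mult intro!: mult_left_mono)
      then have "\<bar>T h x\<bar> \<le> C j"
        unfolding T_eq[OF j] C_def by linarith
      also have "\<dots> \<le> Max (C ` {1..N})"
        using j by (intro Max_ge) auto
      finally show "\<bar>T h x\<bar> \<le> Max (C ` {1..N})" .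
    qed
  qed
  have contr: "Rakotch_contraction_wrt ?B \<phi> T"
    unfolding Rakotch_contraction_wrt_def
  proof (intro conjI ballI)
    fix g h assume gh: "g \<in> mspace ?B" "h \<in> mspace ?B"
    have dist_le: "\<bar>g v - h v\<bar> \<le> mdist ?B g h" if "v \<in> I" for v
      using funspace_mdist_le[OF gh Ine, of "mdist ?B g h"] that by (simp add: dist_real_def)
    \<comment> \<open>The right-hand side depends neither on \<open>x\<close> nor on its piece, so
      the estimate passes to the supremum over \<open>I\<close>.\<close>
    have "\<bar>T g x - T h x\<bar> \<le> \<phi> (mdist ?B g h)" if "x \<in> I" for x
    proof -
      obtain j where j: "j \<in> {1..N}" "x \<in> piece N t j"
        using \<open>x \<in> I\<close> by (rule pieceE)
      show ?thesis
        using \<delta>s_le[OF j(1) dist_le[OF uin[OF j]]] by (simp add: T_eq[OF j])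
    qed
    then show "mdist ?B (T g) (T h) \<le> \<phi> (mdist ?B g h)"
      unfolding funspace_mdist_le[OF Tin[OF gh(1)] Tin[OF gh(2)] Ine] by (simp add: dist_real_def)
  qed (use Tin \<phi> in auto)
  \<comment> \<open>Completeness of the sup metric is inherited from that of the real line; the zero
    function on \<open>I\<close> then shows that the space is nonempty.\<close>
  have "mcomplete_of (bounded_funs I)"
    using Met_TC.mcomplete_funspace[where ?'a = real, of I] complete_UNIV
    by (simp add: euclidean_metric_def Met_TC.Self_def)
  moreover have "(\<lambda>x\<in>I. 0) \<in> mspace ?B"
    by (rule bounded_funsI[of _ 0]) auto
  ultimately obtain f where f: "f \<in> mspace ?B" "T f = f"
    using Rakotch_fixpoint[OF contr] by blast
  have "g = f" if "g \<in> mspace ?B" "T g = g" for g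
    using Rakotch_contraction_wrt_fixpoint_unique[OF contr that(1) f(1) that(2) f(2)] .
  moreover have "f x = c j * inv_into I (l j) x + \<delta> j * s j (f (inv_into I (l j) x)) + d j"
    if "j \<in> {1..N}" "x \<in> piece N t j" for j x
    using T_eq[OF that, of f] by (simp add: f(2) u_def)
  ultimately show ?thesis
    using contr f unfolding Rakotch_contraction_def by blast
qed

end
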